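(* Let $\aleph_0<\lambda$ be a strong limit cardinal and let $\mu>\lambda$ be a regular cardinal. Let $\langle D_\alpha\mid \alpha<\mu\rangle$ be any $\subseteq^*$-increasing sequence of subsets of $\lambda$. Then the sequence $=^*$-stabilizes, i.e. there is $\alpha^*<\mu$ such that $D_\alpha=^*D_{\alpha^*}$ for every $\alpha^*\leq \alpha<\mu$.
   Context: For sets $X,Y$: $X\subseteq^* Y$ means $X\setminus Y$ is finite, and $X=^*Y$ means $X\subseteq^*Y$ and $Y\subseteq^*X$ (i.e. the symmetric difference is finite). *)

theory Defs
  imports Main
begin

unbundle cardinal_syntax

definition almost_subset :: "'a set \<Rightarrow> 'a set \<Rightarrow> bool" (infix "\<subseteq>\<^sup>*" 50)
  where "X \<subseteq>\<^sup>* Y \<longleftrightarrow> finite (X - Y)"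

definition almost_eq :: "'a set \<Rightarrow> 'a set \<Rightarrow> bool" (infix "=\<^sup>*" 50)
  where "X =\<^sup>* Y \<longleftrightarrow> X \<subseteq>\<^sup>* Y \<and> Y \<subseteq>\<^sup>* X"

(* Cardinals are represented, as in the library, by initial well-orders (Card_order): the
   elements of Field r are the ordinals below the cardinal r, and (a, b) \<in> r means a \<le> b.
   In strong_limit, letting k range over cardinals on the type of r is no restriction, since
   every cardinal below r is isomorphic to one whose field is a subset of Field r. *)

definition strong_limit :: "'a rel \<Rightarrow> bool"
  where "strong_limit r \<longleftrightarrow> Card_order r \<and> BNF_Cardinal_Arithmetic.cinfinite r \<and>
    (\<forall>k :: 'a rel. Card_order k \<and> k <o r \<longrightarrow> ctwo ^c k <o r)"

(* The library predicate regularCard is the usual regularity for infinite cardinals only. *)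

definition regular_cardinal :: "'a rel \<Rightarrow> bool"
  where "regular_cardinal r \<longleftrightarrow>
    Card_order r \<and> BNF_Cardinal_Arithmetic.cinfinite r \<and> regularCard r"

end

theory Submission
  imports Defs
begin

text \<open>Since $2^{|x|} < \mu$, the traces of the sequence on a proper initial segment $x$ of
  $\lambda$ take fewer than $\mu$ values, so they stabilize; as $\lambda < \mu$, one index $s$
  works for all $x$. Each $E_\alpha = D_\alpha \setminus D_s$ then has only finitely many
  elements below any point of $\lambda$, so it is countable. A countable $E_\delta$ has fewer
  than $\lambda$ subsets, hence there are fewer than $\lambda$ classes of $E_\alpha$
  modulo finite sets with $\alpha \le \delta$; as any $\lambda$ indices are
  bounded in $\mu$, the $E_\alpha$ fall into fewer than $\mu$ classes altogether and so
  stabilize.\<close>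

section \<open>Inclusion and equality modulo finite sets\<close>

lemma almost_eq_iff: "X =\<^sup>* Y \<longleftrightarrow> finite (X - Y) \<and> finite (Y - X)"
  by (simp add: almost_eq_def almost_subset_def)

lemma almost_subset_refl [simp]: "X \<subseteq>\<^sup>* X"
  by (simp add: almost_subset_def)

lemma almost_subset_trans:
  assumes "X \<subseteq>\<^sup>* Y" and "Y \<subseteq>\<^sup>* Z"
  shows "X \<subseteq>\<^sup>* Z"
proof -
  have "X - Z \<subseteq> (X - Y) \<union> (Y - Z)" by blast
  with assms show ?thesis
    unfolding almost_subset_def by (meson finite_Un finite_subset)
qed

lemma almost_eq_refl [simp]: "X =\<^sup>* X"
  by (simp add: almost_eq_def)

lemma almost_eq_sym: "X =\<^sup>* Y \<Longrightarrow> Y =\<^sup>* X"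
  by (simp add: almost_eq_def)

lemma almost_eq_trans: "X =\<^sup>* Y \<Longrightarrow> Y =\<^sup>* Z \<Longrightarrow> X =\<^sup>* Z"
  unfolding almost_eq_def by (auto intro: almost_subset_trans)

text \<open>Classes turn equality modulo finite sets into true equality, so that the number of
  classes is the cardinality of an image.\<close>

definition almost_class :: "'a set \<Rightarrow> 'a set set"
  where "almost_class X = {S. S =\<^sup>* X}"

lemma almost_class_eq_iff: "almost_class X = almost_class Y \<longleftrightarrow> X =\<^sup>* Y"
  unfolding almost_class_def set_eq_iff mem_Collect_eq
  by (metis almost_eq_refl almost_eq_sym almost_eq_trans)

definition almost_increasing :: "'b rel \<Rightarrow> ('b \<Rightarrow> 'a set) \<Rightarrow> bool"
  where "almost_increasing r D \<longleftrightarrow> (\<forall>(\<alpha>, \<beta>) \<in> r. D \<alpha> \<subseteq>\<^sup>* D \<beta>)"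

lemma almost_increasingD: "almost_increasing r D \<Longrightarrow> (\<alpha>, \<beta>) \<in> r \<Longrightarrow> D \<alpha> \<subseteq>\<^sup>* D \<beta>"
  by (auto simp: almost_increasing_def)

lemma almost_increasing_Int:
  assumes "almost_increasing r D"
  shows "almost_increasing r (\<lambda>\<alpha>. D \<alpha> \<inter> X)"
  unfolding almost_increasing_def
proof safe
  fix \<alpha> \<beta> assume "(\<alpha>, \<beta>) \<in> r"
  then have "finite (D \<alpha> - D \<beta>)"
    using almost_increasingD[OF assms] by (simp add: almost_subset_def)
  then show "D \<alpha> \<inter> X \<subseteq>\<^sup>* D \<beta> \<inter> X"
    unfolding almost_subset_def by (rule rev_finite_subset) blast
qed

lemma almost_increasing_Diff:
  "almost_increasing r D \<Longrightarrow> almost_increasing r (\<lambda>\<alpha>. D \<alpha> - X)"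
  using almost_increasing_Int[of r D "- X"] by (simp add: Diff_eq)

definition almost_stable_from :: "'b rel \<Rightarrow> ('b \<Rightarrow> 'a set) \<Rightarrow> 'b \<Rightarrow> bool"
  where "almost_stable_from r D s \<longleftrightarrow> s \<in> Field r \<and> (\<forall>\<alpha>. (s, \<alpha>) \<in> r \<longrightarrow> D \<alpha> =\<^sup>* D s)"

section \<open>Bounds and regularity in cardinals\<close>

lemma Card_order_trans:
  "Card_order r \<Longrightarrow> (a, b) \<in> r \<Longrightarrow> (b, c) \<in> r \<Longrightarrow> (a, c) \<in> r"
  unfolding card_order_on_def well_order_on_def linear_order_on_def partial_order_on_def
    preorder_on_def by (blast dest: transD)

lemma Card_order_cases:
  assumes "Card_order r" and "a \<in> Field r" and "b \<in> Field r"
  shows "(a, b) \<in> r \<or> (b, a) \<in> r" and "(a, a) \<in> r"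
proof -
  have "Refl r" "Total r"
    using assms(1) unfolding card_order_on_def well_order_on_def linear_order_on_def
      partial_order_on_def preorder_on_def by blast+
  then show "(a, b) \<in> r \<or> (b, a) \<in> r" "(a, a) \<in> r"
    using assms(2,3) unfolding refl_on_def total_on_def by metis+
qed

lemma Card_order_upper_bound:
  assumes "Card_order r" and "a \<in> Field r" and "b \<in> Field r"
  shows "\<exists>c. (a, c) \<in> r \<and> (b, c) \<in> r"
  using assms Card_order_cases by metis

text \<open>Any index past a stabilization point is again one, so sequences that stabilize at
  different points can be treated from a common later index.\<close>

lemma almost_stable_fromD2:
  assumes "Card_order r" and stab: "almost_stable_from r D s"
    and su: "(s, u) \<in> r" and ua: "(u, \<alpha>) \<in> r"
  shows "D \<alpha> =\<^sup>* D u"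
proof -
  have "(s, \<alpha>) \<in> r" using assms(1) su ua by (rule Card_order_trans)
  then have "D \<alpha> =\<^sup>* D s" "D u =\<^sup>* D s"
    using stab su by (simp_all add: almost_stable_from_def)
  then show ?thesis using almost_eq_sym almost_eq_trans by metis
qed

text \<open>A cofinal set has the full cardinality of \<open>r\<close>, so \<open>K\<close> is not
  cofinal: some \<open>d\<close> has no element of \<open>K\<close> strictly above it, and totality
  makes \<open>d\<close> an upper bound.\<close>

lemma regular_cardinal_bounded:
  assumes "regular_cardinal r" and "K \<subseteq> Field r" and "|K| <o r"
  shows "\<exists>d \<in> Field r. \<forall>k \<in> K. (k, d) \<in> r"
proof -
  have co: "Card_order r" and "regularCard r"
    using assms(1) by (auto simp: regular_cardinal_def)
  then have "\<not> cofinal K r"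
    using assms(2,3) not_ordLess_ordIso unfolding regularCard_def by blast
  then obtain d where d: "d \<in> Field r" "\<And>k. k \<in> K \<Longrightarrow> d = k \<or> (d, k) \<notin> r"
    unfolding cofinal_def by blast
  have "(k, d) \<in> r" if "k \<in> K" for k
    using d that assms(2) Card_order_cases[OF co, of k d] by blast
  with d(1) show ?thesis by blast
qed

section \<open>Criteria for stabilization\<close>

lemma almost_stable_if_few_classes:
  assumes reg: "regular_cardinal r" and inc: "almost_increasing r D"
    and few: "|(\<lambda>\<alpha>. almost_class (D \<alpha>)) ` Field r| <o r"
  shows "\<exists>s. almost_stable_from r D s"
proof -
  let ?c = "\<lambda>\<alpha>. almost_class (D \<alpha>)"
  \<comment> \<open>One index is chosen per class, which gives fewer than \<open>r\<close> indices
    and hence a bound \<open>d\<close>. Past \<open>d\<close>, each \<open>D \<alpha>\<close> is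
    almost equal to some \<open>D k\<close> with \<open>k\<close> at most \<open>d\<close>, so it is
    almost contained in \<open>D d\<close>.\<close>
  define R where "R = inv_into (Field r) ?c ` ?c ` Field r"
  have R: "R \<subseteq> Field r"
    unfolding R_def by (auto intro: inv_into_into)
  have "|R| <o r"
    unfolding R_def using card_of_image few by (rule ordLeq_ordLess_trans)
  then obtain d where d: "d \<in> Field r" "\<And>k. k \<in> R \<Longrightarrow> (k, d) \<in> r"
    using regular_cardinal_bounded[OF reg R] by blast
  have "D \<alpha> =\<^sup>* D d" if da: "(d, \<alpha>) \<in> r" for \<alpha>
  proof -
    define k where "k = inv_into (Field r) ?c (?c \<alpha>)"
    have a: "\<alpha> \<in> Field r" using da by (rule FieldI2)
    have "?c k = ?c \<alpha>"
      unfolding k_def using a by (intro f_inv_into_f) blast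
    then have "D \<alpha> \<subseteq>\<^sup>* D k"
      by (simp add: almost_class_eq_iff almost_eq_def)
    moreover have "k \<in> R" using a unfolding R_def k_def by blast
    then have "D k \<subseteq>\<^sup>* D d" using almost_increasingD[OF inc] d(2) by simp
    ultimately have "D \<alpha> \<subseteq>\<^sup>* D d" by (rule almost_subset_trans)
    then show ?thesis
      using almost_increasingD[OF inc da] by (simp add: almost_eq_def)
  qed
  with d(1) show ?thesis unfolding almost_stable_from_def by blast
qed

text \<open>All terms lie in \<open>Pow X\<close>, so there are at most \<open>|Pow X|\<close>
  classes.\<close>

lemma almost_stable_if_few_subsets:
  assumes "regular_cardinal r" and "almost_increasing r D"
    and few: "|Pow X| <o r" and sub: "\<And>\<alpha>. \<alpha> \<in> Field r \<Longrightarrow> D \<alpha> \<subseteq> X"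
  shows "\<exists>s. almost_stable_from r D s"
proof (rule almost_stable_if_few_classes[OF assms(1,2)])
  have "(\<lambda>\<alpha>. almost_class (D \<alpha>)) ` Field r \<subseteq> almost_class ` Pow X"
    using sub by blast
  then have "|(\<lambda>\<alpha>. almost_class (D \<alpha>)) ` Field r| \<le>o |Pow X|"
    using card_of_mono1 ordLeq_transitive[OF _ card_of_image] by metis
  then show "|(\<lambda>\<alpha>. almost_class (D \<alpha>)) ` Field r| <o r"
    using few by (rule ordLeq_ordLess_trans)
qed

text \<open>Too many classes would give \<open>lam\<close> pairwise inequivalent terms below a
  single index \<open>d\<close>. Their traces on \<open>D d\<close> would be \<open>lam\<close>
  distinct subsets of \<open>D d\<close>.\<close>

lemma almost_stable_if_few_subsets_each:
  fixes D :: "'b \<Rightarrow> 'a set"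
  assumes reg: "regular_cardinal mu" and inc: "almost_increasing mu D"
    and lam: "Card_order lam" "lam <o mu"
    and few: "\<And>\<alpha>. \<alpha> \<in> Field mu \<Longrightarrow> |Pow (D \<alpha>)| <o lam"
  shows "\<exists>s. almost_stable_from mu D s"
proof (rule almost_stable_if_few_classes[OF reg inc])
  let ?c = "\<lambda>\<alpha>. almost_class (D \<alpha>)"
  have co: "Card_order mu" using reg by (simp add: regular_cardinal_def)
  show "|?c ` Field mu| <o mu"
  proof (rule ccontr)
    assume "\<not> ?thesis"
    then have "mu \<le>o |?c ` Field mu|"
      using co by (simp add: not_ordLess_iff_ordLeq card_order_on_well_order_on card_of_Well_order)
    \<comment> \<open>Only \<open>lam\<close> of the classes are kept: so few indices are still
      bounded in \<open>mu\<close>.\<close>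
    with ordLess_imp_ordLeq[OF lam(2)] have "lam \<le>o |?c ` Field mu|"
      by (rule ordLeq_transitive)
    with card_of_Field_ordIso[OF lam(1)] have "|Field lam| \<le>o |?c ` Field mu|"
      by (rule ordIso_ordLeq_trans)
    then obtain h where h: "inj_on h (Field lam)" "h ` Field lam \<subseteq> ?c ` Field mu"
      using card_of_ordLeq[of "Field lam" "?c ` Field mu"] by blast
    define k where "k a = inv_into (Field mu) ?c (h a)" for a
    have k: "k a \<in> Field mu" "?c (k a) = h a" if "a \<in> Field lam" for a
    proof -
      have "h a \<in> ?c ` Field mu" using h(2) that by blast
      then show "k a \<in> Field mu" "?c (k a) = h a"
        unfolding k_def by (rule inv_into_into, rule f_inv_into_f)
    qed
    then have sub: "k ` Field lam \<subseteq> Field mu" by blast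
    have card: "|k ` Field lam| <o mu"
      using ordLeq_ordIso_trans[OF card_of_image card_of_Field_ordIso[OF lam(1)]] lam(2)
      by (rule ordLeq_ordLess_trans)
    then obtain d where d: "d \<in> Field mu" "\<And>a. a \<in> Field lam \<Longrightarrow> (k a, d) \<in> mu"
      using regular_cardinal_bounded[OF reg sub] by (metis imageI)
    \<comment> \<open>As \<open>k a\<close> is at most \<open>d\<close>, cutting
      \<open>D (k a)\<close> down to \<open>D d\<close> removes only finitely many points, so the
      trace still determines the class.\<close>
    have trace: "D (k a) \<inter> D d =\<^sup>* D (k a)" if "a \<in> Field lam" for a
    proof -
      have "D (k a) - D (k a) \<inter> D d = D (k a) - D d" by blast
      then show ?thesis
        using almost_increasingD[OF inc d(2)[OF that]]
        by (simp add: almost_eq_iff almost_subset_def Int_Diff)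
    qed
    have "inj_on (\<lambda>a. D (k a) \<inter> D d) (Field lam)"
    proof (rule inj_onI)
      fix a b
      assume ab: "a \<in> Field lam" "b \<in> Field lam" "D (k a) \<inter> D d = D (k b) \<inter> D d"
      then have "D (k a) =\<^sup>* D (k b)"
        using trace[of a] trace[of b] almost_eq_sym almost_eq_trans by metis
      then have "h a = h b"
        using ab k(2) almost_class_eq_iff by metis
      then show "a = b" using h(1) ab by (simp add: inj_on_eq_iff)
    qed
    then have "|Field lam| \<le>o |Pow (D d)|"
      by (intro card_of_ordLeqI) auto
    then have "lam \<le>o |Pow (D d)|"
      by (rule ordIso_ordLeq_trans[OF ordIso_symmetric[OF card_of_Field_ordIso[OF lam(1)]]])
    with few[OF d(1)] show False using not_ordLess_ordLeq by blast
  qed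
qed

section \<open>Power sets below a strong limit, and countability\<close>

lemma strong_limit_Pow:
  fixes lam :: "'a rel" and X :: "'a set"
  assumes "strong_limit lam" and "|X| <o lam"
  shows "|Pow X| <o lam"
proof -
  have "ctwo ^c |X| <o lam"
    using assms card_of_Card_order[of X] unfolding strong_limit_def by blast
  moreover have "|Pow X| =o ctwo ^c |X|"
    unfolding cexp_def ctwo_def Field_card_of by (rule card_of_Pow_Func)
  ultimately show ?thesis by (metis ordIso_ordLess_trans)
qed

text \<open>Sending each point of \<open>E\<close> to the number of points of \<open>E\<close>
  strictly below it is strictly increasing, hence an injection into the natural numbers.\<close>

lemma countable_if_finite_initial_segments:
  assumes wo: "Well_order r" and E: "E \<subseteq> Field r"
    and fin: "\<And>a. a \<in> E \<Longrightarrow> finite (E \<inter> underS r a)"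
  shows "|E| \<le>o natLeq"
proof -
  have r: "trans r" "antisym r" "Total r"
    using wo
    by (auto simp: well_order_on_def linear_order_on_def partial_order_on_def preorder_on_def)
  have less: "card (E \<inter> underS r a) < card (E \<inter> underS r b)"
    if "a \<in> E" "b \<in> E" "a \<noteq> b" "(a, b) \<in> r" for a b
  proof (rule psubset_card_mono[OF fin[OF that(2)]])
    have "underS r a \<subseteq> underS r b"
      using that r unfolding underS_def by (auto dest: transD antisymD)
    \<comment> \<open>The point \<open>a\<close> itself makes the inclusion proper.\<close>
    moreover have "a \<in> underS r b" "a \<notin> underS r a"
      using that by (auto simp: underS_def)
    ultimately show "E \<inter> underS r a \<subset> E \<inter> underS r b"
      using that(1) by blast
  qed
  have "inj_on (\<lambda>a. card (E \<inter> underS r a)) E"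
  proof (rule inj_onI, rule ccontr)
    fix a b
    assume ab: "a \<in> E" "b \<in> E" "card (E \<inter> underS r a) = card (E \<inter> underS r b)" "a \<noteq> b"
    then have "(a, b) \<in> r \<or> (b, a) \<in> r"
      using r(3) E unfolding total_on_def by blast
    with ab less[of a b] less[of b a] show False by auto
  qed
  then have "|E| \<le>o |UNIV :: nat set|"
    by (intro card_of_ordLeqI) auto
  then show ?thesis using card_of_nat by (rule ordLeq_ordIso_trans)
qed

theorem theorem2p34:
  fixes lam :: "'a rel" and mu :: "'b rel" and D :: "'b \<Rightarrow> 'a set"
  assumes "natLeq <o lam" and "strong_limit lam"
    and "regular_cardinal mu" and "lam <o mu"
    and "\<And>\<alpha>. \<alpha> \<in> Field mu \<Longrightarrow> D \<alpha> \<subseteq> Field lam"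
    and "\<And>\<alpha> \<beta>. (\<alpha>, \<beta>) \<in> mu \<Longrightarrow> \<alpha> \<noteq> \<beta> \<Longrightarrow> D \<alpha> \<subseteq>\<^sup>* D \<beta>"
  shows "\<exists>\<alpha>s \<in> Field mu. \<forall>\<alpha>. (\<alpha>s, \<alpha>) \<in> mu \<longrightarrow> D \<alpha> =\<^sup>* D \<alpha>s"
proof -
  have lam: "Card_order lam" using assms(2) by (simp add: strong_limit_def)
  \<comment> \<open>The last hypothesis concerns distinct indices; the diagonal pairs in
    \<open>almost_increasing\<close> are covered by reflexivity.\<close>
  have mu: "Card_order mu" using assms(3) by (simp add: regular_cardinal_def)
  have inc: "almost_increasing mu D"
    using assms(6) unfolding almost_increasing_def by (metis almost_subset_refl case_prodI2)
  have "\<exists>s. almost_stable_from mu (\<lambda>\<alpha>. D \<alpha> \<inter> underS lam a) s" if "a \<in> Field lam" for a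
  proof (rule almost_stable_if_few_subsets[OF assms(3) almost_increasing_Int[OF inc]])
    have "|underS lam a| <o lam" using lam that by (rule card_of_underS)
    from strong_limit_Pow[OF assms(2) this] assms(4) show "|Pow (underS lam a)| <o mu"
      by (rule ordLess_transitive)
  qed blast
  then obtain t
    where t: "\<And>a. a \<in> Field lam \<Longrightarrow> almost_stable_from mu (\<lambda>\<alpha>. D \<alpha> \<inter> underS lam a) (t a)"
    by metis
  have card: "|t ` Field lam| <o mu"
    using ordLeq_ordIso_trans[OF card_of_image card_of_Field_ordIso[OF lam]] assms(4)
    by (rule ordLeq_ordLess_trans)
  have "t ` Field lam \<subseteq> Field mu"
    using t by (auto simp: almost_stable_from_def)
  \<comment> \<open>The index \<open>s\<close> lies above the stabilization points
    \<open>t a\<close> of all the traces at once.\<close>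
  from regular_cardinal_bounded[OF assms(3) this card] obtain s where s: "s \<in> Field mu" "\<And>a. a \<in> Field lam \<Longrightarrow> (t a, s) \<in> mu"
    by (metis imageI)
  define E where "E \<alpha> = D \<alpha> - D s" for \<alpha>
  have Einc: "almost_increasing mu E"
    unfolding E_def by (rule almost_increasing_Diff[OF inc])
  have Efin: "finite (E \<alpha> \<inter> underS lam a)" if \<alpha>: "\<alpha> \<in> Field mu" and a: "a \<in> Field lam" for \<alpha> a
  proof -
    let ?u = "underS lam a"
    \<comment> \<open>The index \<open>\<alpha>\<close> may lie below \<open>s\<close>. The trace is
      therefore compared at some \<open>b\<close> above both, at the cost of the finite set
      \<open>D \<alpha> - D b\<close>.\<close>
    obtain b where b: "(\<alpha>, b) \<in> mu" "(s, b) \<in> mu"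
      using Card_order_upper_bound[OF mu \<alpha> s(1)] by blast
    have "D b \<inter> ?u =\<^sup>* D s \<inter> ?u"
      using almost_stable_fromD2[OF mu t[OF a] s(2)[OF a] b(2)] by simp
    then have "finite (D b \<inter> ?u - D s \<inter> ?u)" by (simp add: almost_eq_iff)
    moreover have "finite (D \<alpha> - D b)"
      using almost_increasingD[OF inc b(1)] by (simp add: almost_subset_def)
    moreover have "E \<alpha> \<inter> ?u \<subseteq> (D b \<inter> ?u - D s \<inter> ?u) \<union> (D \<alpha> - D b)"
      unfolding E_def by blast
    ultimately show ?thesis by (meson finite_Un finite_subset)
  qed
  have "|Pow (E \<alpha>)| <o lam" if \<alpha>: "\<alpha> \<in> Field mu" for \<alpha>
  proof (rule strong_limit_Pow[OF assms(2)])
    have sub: "E \<alpha> \<subseteq> Field lam" using assms(5)[OF \<alpha>] by (auto simp: E_def)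
    have "|E \<alpha>| \<le>o natLeq"
      using card_order_on_well_order_on[OF lam] sub
      by (rule countable_if_finite_initial_segments) (use Efin \<alpha> sub in blast)
    \<comment> \<open>Uncountability of \<open>lam\<close> enters here.\<close>
    then show "|E \<alpha>| <o lam" using assms(1) by (rule ordLeq_ordLess_trans)
  qed
  then obtain e where e: "almost_stable_from mu E e"
    using almost_stable_if_few_subsets_each[OF assms(3) Einc lam assms(4)] by blast
  then have "e \<in> Field mu" by (simp add: almost_stable_from_def)
  \<comment> \<open>Being above \<open>e\<close>, the index \<open>m\<close> controls the part
    outside \<open>D s\<close>; being above \<open>s\<close>, it makes \<open>D m\<close> almost
    contain \<open>D s\<close>.\<close>
  then obtain m where m: "(e, m) \<in> mu" "(s, m) \<in> mu"
    using Card_order_upper_bound[OF mu _ s(1)] by blast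
  have "D \<alpha> =\<^sup>* D m" if ma: "(m, \<alpha>) \<in> mu" for \<alpha>
  proof -
    have "E \<alpha> =\<^sup>* E m"
      by (rule almost_stable_fromD2[OF mu e m(1) ma])
    then have "finite (E \<alpha> - E m)" by (simp add: almost_eq_iff)
    moreover have "finite (D s - D m)"
      using almost_increasingD[OF inc m(2)] by (simp add: almost_subset_def)
    \<comment> \<open>A point of the difference either lies in \<open>D s\<close>, or lies in
      \<open>E \<alpha>\<close> and, being outside \<open>D m\<close>, not in
      \<open>E m\<close>.\<close>
    moreover have "D \<alpha> - D m \<subseteq> (E \<alpha> - E m) \<union> (D s - D m)"
      unfolding E_def by blast
    ultimately have "D \<alpha> \<subseteq>\<^sup>* D m"
      unfolding almost_subset_def by (meson finite_Un finite_subset)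
    then show ?thesis
      using almost_increasingD[OF inc ma] by (simp add: almost_eq_def)
  qed
  moreover have "m \<in> Field mu" using m(1) by (rule FieldI2)
  ultimately show ?thesis by blast
qed

end
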